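(* For every $\alpha\in(0,1)$, $\mathbb{M}_{\alpha+}=\mathbb{M}_\alpha$. Moreover, $\mathbb{M}_{0+}\neq\mathbb{M}_0$ and for $0<\alpha<\beta\le1$, $$\mathbb{M}_0\subset\mathbb{M}_{0+}\subset\mathbb{M}_\alpha\subset\mathbb{M}_\beta .$$
   Context: Notation. $\mathbb{M}_1$ is the family of all probability distributions supported in $\mathbb{Z}_+=\{0,1,2,\ldots\}$; $X\in\mathbb{M}_1$ means that the distribution of the random variable $X$ is in $\mathbb{M}_1$. For $X\in\mathbb{M}_1$ and $\alpha\in[0,1]$, $\alpha\circ X$ denotes a random variable distributed as $\sum_{i=1}^X B_i$ (empty sum $=0$), where $B_1,B_2,\ldots$ are i.i.d. with $P(B_i=1)=\alpha=1-P(B_i=0)$, independent of $X$. $\mathbb{M}_\alpha$ is the set of all distributions of $\alpha\circ Z$ with $Z\in\mathbb{M}_1$ (so $\mathbb{M}_0$ contains only the distribution of the constant $0$). For $\alpha\in[0,1)$, $\mathbb{M}_{\alpha+}=\bigcap_{\gamma\in(\alpha,1]}\mathbb{M}_\gamma$. *)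

theory Defs
  imports "HOL-Probability.Probability"
begin

text \<open>
  A probability distribution supported in the nonnegative integers is a \<^typ>\<open>nat pmf\<close>, so the
  family of all of them is \<^term>\<open>UNIV :: nat pmf set\<close>.

  The law of \<open>B\<^sub>1 + \<dots> + B\<^sub>X\<close> with \<open>X \<sim> p\<close> and i.i.d. Bernoulli variables \<open>B\<^sub>i\<close> independent
  of \<open>X\<close>: by independence, given \<open>X = n\<close> the vector \<open>(B\<^sub>1, \<dots>, B\<^sub>n)\<close> still has the product law.
  \<^const>\<open>bernoulli_pmf\<close> clips its parameter to the unit interval; only \<open>0 \<le> \<alpha> \<le> 1\<close> is meant.
\<close>

definition thinning :: "real \<Rightarrow> nat pmf \<Rightarrow> nat pmf" where
  "thinning \<alpha> p =
     bind_pmf p (\<lambda>n. map_pmf (\<lambda>B. \<Sum>i = 1..n. of_bool (B i))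
                       (Pi_pmf {1..n} False (\<lambda>_. bernoulli_pmf \<alpha>)))"

definition thinned :: "real \<Rightarrow> nat pmf set" where
  "thinned \<alpha> = {thinning \<alpha> p | p. p \<in> UNIV}"

definition thinned_plus :: "real \<Rightarrow> nat pmf set" where
  "thinned_plus \<alpha> = (\<Inter>\<gamma>\<in>{\<alpha><..1}. thinned \<gamma>)"

lemma thinning_eq_binomial:
  assumes "\<alpha> \<in> {0..1}"
  shows "thinning \<alpha> p = bind_pmf p (\<lambda>n. binomial_pmf n \<alpha>)"
proof -
  have "map_pmf (\<lambda>B. \<Sum>i = 1..n. of_bool (B i)) (Pi_pmf {1..n} False (\<lambda>_. bernoulli_pmf \<alpha>))
          = binomial_pmf n \<alpha>" for n :: nat
  proof -
    have "(\<Sum>i = 1..n. of_bool (B i)) = card {i \<in> {1..n}. B i}" for B :: "nat \<Rightarrow> bool"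
      by (simp add: of_bool_def sum.If_cases Int_def)
    then show ?thesis
      using binomial_pmf_altdef'[of "{1..n}" n \<alpha> False] assms by simp
  qed
  then show ?thesis
    by (simp add: thinning_def)
qed

lemma thinning_1: "thinning 1 p = p"
proof -
  have "binomial_pmf n 1 = return_pmf n" for n
    using set_pmf_subset_singleton[of "binomial_pmf n 1" n] by simp
  then show ?thesis
    by (simp add: thinning_eq_binomial bind_return_pmf')
qed

lemma thinned_1: "thinned 1 = UNIV"
  by (auto simp: thinned_def thinning_1)

lemma thinned_0: "thinned 0 = {return_pmf 0}"
proof -
  have "binomial_pmf n 0 = return_pmf 0" for n
    using set_pmf_subset_singleton[of "binomial_pmf n 0" 0] by simp
  then show ?thesis
    by (auto simp: thinned_def thinning_eq_binomial)
qed

end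

theory Submission
  imports Defs
begin

text \<open>
  Thinning by \<open>\<alpha>\<close> and then by \<open>\<beta>\<close> keeps each of the counted units with probability \<open>\<alpha> * \<beta>\<close>
  (\<open>thinning_thinning\<close>), so the families grow with the parameter. They grow strictly: a Bernoulli
  law with success probability \<open>\<beta>\<close> is the thinning by \<open>\<beta>\<close> of the point mass at 1, but for
  \<open>0 < \<alpha> < \<beta>\<close> a law \<open>\<alpha> \<circ> Z\<close> carried by \<open>{0, 1}\<close> forces \<open>Z \<le> 1\<close>, and then it charges 1 with
  mass at most \<open>\<alpha>\<close> (\<open>pmf_1_thinning_le\<close>). Since the families are nested,
  \<open>thinned_plus 0\<close> lies in \<open>thinned (\<alpha> / 2)\<close>, hence strictly inside \<open>thinned \<alpha>\<close>. It contains
  more than the point mass at 0 because a thinned Poisson law is again Poisson, so that a Poisson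
  law is a thinning by every positive parameter.

  The remaining part is right-continuity at \<open>\<alpha> > 0\<close> (\<open>thinned_closed_from_above\<close>), a compactness
  argument. Let \<open>q\<close> be the law of \<open>\<gamma>\<^sub>n \<circ> Z\<^sub>n\<close> with \<open>\<gamma>\<^sub>n > \<alpha>\<close> tending to \<open>\<alpha>\<close>. Along a subsequence the
  mass functions of the \<open>Z\<^sub>n\<close> converge pointwise to some \<open>l\<close>. The binomial weight of \<open>j\<close> among \<open>k\<close>
  trials with success probability \<open>\<gamma>\<^sub>n \<ge> \<alpha>\<close> is at most \<open>(k choose j) * (1 - \<alpha>) ^ (k - j)\<close>,
  which is summable over \<open>k\<close> exactly because \<open>\<alpha> > 0\<close>. By dominated convergence \<open>q\<close> is the
  \<open>\<alpha>\<close>-thinning of \<open>l\<close>. The limit \<open>l\<close> is a probability distribution because thinning preserves total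
  mass and \<open>q\<close> has total mass 1.
\<close>

section \<open>Composition of thinnings\<close>

lemma bernoulli_thinning:
  assumes "\<alpha> \<in> {0..1}" "\<beta> \<in> {0..1}"
  shows "bind_pmf (bernoulli_pmf \<alpha>) (\<lambda>b. if b then bernoulli_pmf \<beta> else return_pmf False)
           = bernoulli_pmf (\<alpha> * \<beta>)" (is "?L = ?R")
proof -
  have ab: "\<alpha> * \<beta> \<in> {0..1}"
    using assms by (auto intro: mult_le_one)
  have T: "pmf ?L True = pmf ?R True"
    using assms ab by (simp add: pmf_bind)
  have F: "pmf ?L False = pmf ?R False"
    using assms ab by (simp add: pmf_bind algebra_simps)
  show ?thesis
  proof (rule pmf_eqI)
    show "pmf ?L b = pmf ?R b" for b
      using T F by (cases b) simp_all
  qed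
qed

text \<open>
  By induction on the number of trials: the first trial contributes a thinned Bernoulli variable,
  independent of the thinned count of the others.
\<close>

lemma binomial_thinning:
  assumes "\<alpha> \<in> {0..1}" "\<beta> \<in> {0..1}"
  shows "bind_pmf (binomial_pmf n \<alpha>) (\<lambda>k. binomial_pmf k \<beta>) = binomial_pmf n (\<alpha> * \<beta>)"
proof -
  have ab: "\<alpha> * \<beta> \<in> {0..1}"
    using assms by (auto intro: mult_le_one)
  show ?thesis
  proof (induction n)
    case 0
    then show ?case
      using assms ab by (simp add: binomial_pmf_0 bind_return_pmf)
  next
    case (Suc n)
    \<comment> \<open>Splits off the unit counted by the first trial, if there is one, so that its thinning can be
      moved in front of the other trials.\<close>
    have step: "binomial_pmf (of_bool b + k) \<beta>
            = bind_pmf (if b then bernoulli_pmf \<beta> else return_pmf False)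
                (\<lambda>c. map_pmf (\<lambda>m. of_bool c + m) (binomial_pmf k \<beta>))" for b k
      using assms(2)
      by (cases b) (auto simp: binomial_pmf_Suc bind_return_pmf map_pmf_def of_bool_def
          bind_return_pmf' intro!: bind_pmf_cong)
    have "bind_pmf (binomial_pmf (Suc n) \<alpha>) (\<lambda>k. binomial_pmf k \<beta>)
        = bind_pmf (bernoulli_pmf \<alpha>) (\<lambda>b. bind_pmf (binomial_pmf n \<alpha>)
            (\<lambda>k. binomial_pmf (of_bool b + k) \<beta>))"
      using assms(1) by (simp add: binomial_pmf_Suc bind_assoc_pmf bind_return_pmf of_bool_def)
    also have "\<dots> = bind_pmf (bernoulli_pmf \<alpha>) (\<lambda>b.
            bind_pmf (if b then bernoulli_pmf \<beta> else return_pmf False) (\<lambda>c.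
              bind_pmf (binomial_pmf n \<alpha>) (\<lambda>k.
                map_pmf (\<lambda>m. of_bool c + m) (binomial_pmf k \<beta>))))"
      unfolding step by (subst bind_commute_pmf) (rule refl)
    also have "\<dots> = bind_pmf (bind_pmf (bernoulli_pmf \<alpha>)
              (\<lambda>b. if b then bernoulli_pmf \<beta> else return_pmf False))
            (\<lambda>c. map_pmf (\<lambda>m. of_bool c + m)
              (bind_pmf (binomial_pmf n \<alpha>) (\<lambda>k. binomial_pmf k \<beta>)))"
      by (simp add: bind_assoc_pmf map_bind_pmf)
    also have "\<dots> = bind_pmf (bernoulli_pmf (\<alpha> * \<beta>))
            (\<lambda>c. map_pmf (\<lambda>m. of_bool c + m) (binomial_pmf n (\<alpha> * \<beta>)))"
      using assms Suc.IH by (simp add: bernoulli_thinning)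
    also have "\<dots> = binomial_pmf (Suc n) (\<alpha> * \<beta>)"
      using ab by (simp add: binomial_pmf_Suc map_pmf_def of_bool_def)
    finally show ?case .
  qed
qed

lemma thinning_thinning:
  assumes "\<alpha> \<in> {0..1}" "\<beta> \<in> {0..1}"
  shows "thinning \<beta> (thinning \<alpha> p) = thinning (\<alpha> * \<beta>) p"
proof -
  have "\<alpha> * \<beta> \<in> {0..1}"
    using assms by (auto intro: mult_le_one)
  then show ?thesis
    using assms by (simp add: thinning_eq_binomial bind_assoc_pmf binomial_thinning)
qed

lemma thinned_mono:
  assumes "0 \<le> \<alpha>" "\<alpha> \<le> \<beta>" "\<beta> \<le> 1"
  shows "thinned \<alpha> \<subseteq> thinned \<beta>"
proof (cases "\<beta> = 0")
  case True
  then show ?thesis using assms by simp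
next
  case False
  \<comment> \<open>The missing factor \<open>\<alpha> / \<beta>\<close> is a probability, so it can be absorbed into the thinned law.\<close>
  then have "thinning \<alpha> p = thinning \<beta> (thinning (\<alpha> / \<beta>) p)" for p
    using assms by (simp add: thinning_thinning)
  then show ?thesis
    unfolding thinned_def by blast
qed

section \<open>Strictness\<close>

lemma pmf_thinning:
  assumes "\<alpha> \<in> {0..1}"
  shows "ennreal (pmf (thinning \<alpha> p) j)
           = (\<integral>\<^sup>+ n. ennreal (pmf p n * pmf (binomial_pmf n \<alpha>) j) \<partial>count_space UNIV)"
  using assms
  by (simp add: thinning_eq_binomial ennreal_pmf_bind nn_integral_measure_pmf ennreal_mult)

text \<open>
  With positive probability all \<open>n\<close> units survive, so every value \<open>n\<close> of \<open>p\<close> is also a value of the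
  thinned law. Hence \<open>p\<close> itself is carried by \<open>{0, 1}\<close>, and a single unit survives with
  probability \<open>\<alpha>\<close>.
\<close>

lemma pmf_1_thinning_le:
  assumes a: "0 < \<alpha>" "\<alpha> \<le> 1" and le1: "set_pmf (thinning \<alpha> p) \<subseteq> {..1}"
  shows "pmf (thinning \<alpha> p) 1 \<le> \<alpha>"
proof -
  have n1: "n \<le> 1" if "n \<in> set_pmf p" for n
  proof -
    have "n \<in> set_pmf (binomial_pmf n \<alpha>)"
      using a by (auto simp: set_pmf_iff)
    then show ?thesis
      using that le1 a by (auto simp: thinning_eq_binomial)
  qed
  have "pmf (binomial_pmf n \<alpha>) 1 \<le> \<alpha>" if "n \<in> set_pmf p" for n
    using n1[OF that] a by (cases n) auto
  then have "(\<integral>\<^sup>+n. ennreal (pmf (binomial_pmf n \<alpha>) 1) \<partial>measure_pmf p)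
               \<le> (\<integral>\<^sup>+n. ennreal \<alpha> \<partial>measure_pmf p)"
    by (intro nn_integral_mono_AE) (auto simp: AE_measure_pmf_iff intro!: ennreal_leI)
  then have "ennreal (pmf (thinning \<alpha> p) 1) \<le> ennreal \<alpha>"
    using a by (simp add: thinning_eq_binomial ennreal_pmf_bind)
  then show ?thesis
    using a by simp
qed

lemma thinned_strict_mono:
  assumes "0 < \<alpha>" "\<alpha> < \<beta>" "\<beta> \<le> 1"
  shows "thinned \<alpha> \<subset> thinned \<beta>"
proof
  show "thinned \<alpha> \<subseteq> thinned \<beta>"
    using assms by (intro thinned_mono) auto
  have law: "thinning \<beta> (return_pmf 1) = binomial_pmf 1 \<beta>"
    using assms by (simp add: thinning_eq_binomial bind_return_pmf)
  have "binomial_pmf 1 \<beta> \<notin> thinned \<alpha>"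
  proof
    assume "binomial_pmf 1 \<beta> \<in> thinned \<alpha>"
    then obtain p where p: "binomial_pmf 1 \<beta> = thinning \<alpha> p"
      by (auto simp: thinned_def)
    have "set_pmf (binomial_pmf 1 \<beta>) \<subseteq> {..1}"
      using assms by (auto simp: set_pmf_binomial_eq)
    then have "pmf (binomial_pmf 1 \<beta>) 1 \<le> \<alpha>"
      using pmf_1_thinning_le[of \<alpha> p] assms unfolding p by simp
    then show False
      using assms by simp
  qed
  moreover have "binomial_pmf 1 \<beta> \<in> thinned \<beta>"
    unfolding thinned_def law[symmetric] by auto
  ultimately show "thinned \<alpha> \<noteq> thinned \<beta>"
    by metis
qed

section \<open>Poisson laws\<close>

text \<open>
  Summing over \<open>n = m + j\<close> units before thinning, the \<open>m\<close> lost ones contribute an exponential series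
  with argument \<open>(1 - \<alpha>) * r\<close>, which turns the factor \<open>exp (- r)\<close> into \<open>exp (- \<alpha> * r)\<close>.
\<close>

lemma thinning_poisson:
  assumes a: "\<alpha> \<in> {0<..1}" and r: "0 < r"
  shows "thinning \<alpha> (poisson_pmf r) = poisson_pmf (\<alpha> * r)"
proof (rule pmf_eqI)
  fix j
  have ar: "0 < \<alpha> * r" using a r by simp
  define g where "g n = pmf (poisson_pmf r) n * pmf (binomial_pmf n \<alpha>) j" for n
  have g0: "g n \<ge> 0" for n by (simp add: g_def)
  have gs: "g (m + j) = (exp (-r) * (\<alpha> * r) ^ j / fact j) * (((1 - \<alpha>) * r) ^ m /\<^sub>R fact m)" for m
    using a r
    by (simp add: g_def binomial_fact divide_simps power_add power_mult_distrib mult_ac)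
  have "(\<lambda>m. g (m + j)) sums ((exp (-r) * (\<alpha> * r) ^ j / fact j) * exp ((1 - \<alpha>) * r))"
    unfolding gs by (intro sums_mult exp_converges)
  moreover have "(\<Sum>n<j. g n) = 0"
    using a by (intro sum.neutral) (auto simp: g_def)
  ultimately have "g sums ((exp (-r) * (\<alpha> * r) ^ j / fact j) * exp ((1 - \<alpha>) * r))"
    by (simp add: sums_iff_shift)
  also have "(exp (-r) * (\<alpha> * r) ^ j / fact j) * exp ((1 - \<alpha>) * r) = pmf (poisson_pmf (\<alpha> * r)) j"
    using ar by (simp add: pmf_poisson field_simps flip: exp_add)
  finally have gsum: "g sums pmf (poisson_pmf (\<alpha> * r)) j" .
  have "ennreal (pmf (thinning \<alpha> (poisson_pmf r)) j) = (\<Sum>n. ennreal (g n))"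
    using a by (simp add: pmf_thinning nn_integral_count_space_nat g_def)
  also have "\<dots> = ennreal (pmf (poisson_pmf (\<alpha> * r)) j)"
    using gsum g0 by (intro suminf_ennreal_eq)
  finally show "pmf (thinning \<alpha> (poisson_pmf r)) j = pmf (poisson_pmf (\<alpha> * r)) j"
    by simp
qed

lemma poisson_in_thinned_plus_0:
  assumes "0 < r"
  shows "poisson_pmf r \<in> thinned_plus 0"
proof -
  have "poisson_pmf r = thinning \<gamma> (poisson_pmf (r / \<gamma>))" if "\<gamma> \<in> {0<..1}" for \<gamma>
    using that assms by (subst thinning_poisson) auto
  then show ?thesis
    unfolding thinned_plus_def thinned_def by blast
qed

section \<open>Right-continuity of the families\<close>

text \<open>
  By Tychonoff the set of functions with values in \<open>{a..b}\<close> is compact in the product topology. That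
  topology is metrizable, as there are only countably many coordinates, so compactness yields
  convergent subsequences.
\<close>

lemma bounded_sequences_pointwise_compact:
  fixes f :: "nat \<Rightarrow> 'a::countable \<Rightarrow> real"
  assumes "\<And>n k. f n k \<in> {a..b}"
  obtains l r where "strict_mono (r :: nat \<Rightarrow> nat)"
    and "\<And>k. (\<lambda>n. f (r n) k) \<longlonglongrightarrow> l k" "\<And>k. l k \<in> {a..b}"
proof -
  have "compact (PiE UNIV (\<lambda>_::'a. {a..b}))"
    using compactin_PiE[of "\<lambda>_::'a. euclidean::real topology" UNIV "\<lambda>_. {a..b}"]
    by (simp add: euclidean_product_topology)
  moreover have "\<forall>n. f n \<in> PiE UNIV (\<lambda>_::'a. {a..b})"
    using assms by (auto simp: PiE_def)
  ultimately obtain l r where l: "l \<in> PiE UNIV (\<lambda>_::'a. {a..b})" and r: "strict_mono r"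
    and lim: "(f \<circ> r) \<longlonglongrightarrow> l"
    unfolding compact_eq_seq_compact_metric seq_compact_def by meson
  have "(\<lambda>n. f (r n) k) \<longlonglongrightarrow> l k" for k
    using continuous_on_tendsto_compose[OF continuous_on_product_coordinates[where i = k] lim]
    by (simp add: o_def)
  then show ?thesis
    by (rule that[OF r _ PiE_mem[OF l UNIV_I]])
qed

text \<open>
  Up to the factor \<open>(1 - x) ^ Suc j\<close> and a shift by \<open>j\<close>, the terms are the probabilities of a negative
  binomial distribution.
\<close>

lemma summable_binomial_tail:
  fixes x :: real
  assumes "0 \<le> x" "x < 1"
  shows "summable (\<lambda>n. real (n choose j) * x ^ (n - j))"
proof -
  define c where "c = (1 - x) ^ Suc j"
  have c: "c \<noteq> 0" using assms by (simp add: c_def)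
  have "(\<Sum>k. ennreal (pmf (neg_binomial_pmf (Suc j) (1 - x)) k)) = 1"
    using nn_integral_pmf_eq_1[of "neg_binomial_pmf (Suc j) (1 - x)"]
    by (simp add: nn_integral_count_space_nat)
  then have "summable (\<lambda>k. pmf (neg_binomial_pmf (Suc j) (1 - x)) k)"
    by (intro summable_suminf_not_top) auto
  also have "(\<lambda>k. pmf (neg_binomial_pmf (Suc j) (1 - x)) k)
               = (\<lambda>k. c * (real ((k + j) choose j) * x ^ k))"
    using assms binomial_symmetric[of j "_ + j"]
    by (subst pmf_neg_binomial) (auto simp: c_def mult_ac)
  finally have "summable (\<lambda>k. real ((k + j) choose j) * x ^ (k + j - j))"
    using c by (simp add: summable_cmult_iff)
  then show ?thesis
    using summable_iff_shift[of "\<lambda>n. real (n choose j) * x ^ (n - j)" j] by simp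
qed

text \<open>
  If \<open>q\<close> is the thinning by \<open>\<gamma> n\<close> of a law \<open>z n\<close>, the mass functions of the \<open>z n\<close> have a pointwise limit
  along a subsequence, and \<open>q\<close> is the \<open>\<alpha>\<close>-thinning of that limit. The lower bound \<open>0 < \<alpha> \<le> \<gamma> n\<close>
  keeps the mass of \<open>z n\<close> from escaping to infinity. For \<open>\<alpha> = 0\<close> it can escape: a Poisson law \<open>q\<close>
  with mean \<open>r\<close> comes from Poisson laws \<open>z n\<close> with means \<open>r / \<gamma> n\<close>.
\<close>

lemma thinned_closed_from_above:
  assumes a: "0 < \<alpha>" "\<alpha> \<le> 1"
    and g: "\<And>n. \<gamma> n \<in> {\<alpha>..1}" "\<gamma> \<longlonglongrightarrow> \<alpha>"
    and q: "\<And>n. q \<in> thinned (\<gamma> n)"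
  shows "q \<in> thinned \<alpha>"
proof -
  have a01: "\<alpha> \<in> {0..1}" and g01: "\<And>n. \<gamma> n \<in> {0..1}"
    using a g(1) by (auto intro: order_trans[OF less_imp_le])
  have "\<exists>p. q = thinning (\<gamma> n) p" for n
    using q[of n] by (auto simp: thinned_def)
  then obtain z where z: "\<And>n. q = thinning (\<gamma> n) (z n)"
    by metis
  obtain l r where r: "strict_mono (r :: nat \<Rightarrow> nat)"
    and lim: "\<And>k. (\<lambda>n. pmf (z (r n)) k) \<longlonglongrightarrow> l k" and l01: "\<And>k. l k \<in> {0..1}"
    by (rule bounded_sequences_pointwise_compact[of "\<lambda>n. pmf (z n)" 0 1])
       (auto simp: pmf_le_1)
  have l0: "0 \<le> l k" for k using l01[of k] by simp
  have gr: "(\<lambda>n. \<gamma> (r n)) \<longlonglongrightarrow> \<alpha>"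
    using LIMSEQ_subseq_LIMSEQ[OF g(2) r] by (simp add: o_def)
  have q_eq: "(\<integral>\<^sup>+ k. ennreal (l k * pmf (binomial_pmf k \<alpha>) j) \<partial>count_space UNIV)
                = ennreal (pmf q j)" for j
  proof -
    define u where "u n k = ennreal (pmf (z (r n)) k * pmf (binomial_pmf k (\<gamma> (r n))) j)" for n k
    define w where "w k = ennreal (real (k choose j) * (1 - \<alpha>) ^ (k - j))" for k
    have "(\<lambda>n. \<integral>\<^sup>+ k. u n k \<partial>count_space UNIV)
            \<longlonglongrightarrow> (\<integral>\<^sup>+ k. ennreal (l k * pmf (binomial_pmf k \<alpha>) j) \<partial>count_space UNIV)"
    proof (rule nn_integral_dominated_convergence)
      show "u n \<in> borel_measurable (count_space UNIV)" for n by simp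
      show "(\<lambda>k. ennreal (l k * pmf (binomial_pmf k \<alpha>) j)) \<in> borel_measurable (count_space UNIV)"
        by simp
      show "w \<in> borel_measurable (count_space UNIV)" by simp
      show "AE k in count_space UNIV. u n k \<le> w k" for n
      proof (rule AE_I2)
        fix k
        have "pmf (binomial_pmf k (\<gamma> (r n))) j
                = real (k choose j) * (\<gamma> (r n) ^ j * (1 - \<gamma> (r n)) ^ (k - j))"
          using g01 by simp
        also have "\<dots> \<le> real (k choose j) * (1 * (1 - \<alpha>) ^ (k - j))"
          using g(1)[of "r n"] g01[of "r n"]
          by (intro mult_left_mono mult_mono power_mono power_le_one) auto
        finally have "pmf (z (r n)) k * pmf (binomial_pmf k (\<gamma> (r n))) j
                        \<le> 1 * (real (k choose j) * (1 - \<alpha>) ^ (k - j))"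
          by (intro mult_mono) (auto simp: pmf_le_1)
        then show "u n k \<le> w k"
          unfolding u_def w_def by (intro ennreal_leI) simp
      qed
      have "summable (\<lambda>k. real (k choose j) * (1 - \<alpha>) ^ (k - j))"
        using a by (intro summable_binomial_tail) auto
      then have "(\<Sum>k. w k) \<noteq> top"
        unfolding w_def using a by (subst suminf_ennreal2) auto
      then show "(\<integral>\<^sup>+ k. w k \<partial>count_space UNIV) < \<infinity>"
        by (simp add: nn_integral_count_space_nat less_top)
      show "AE k in count_space UNIV. (\<lambda>n. u n k) \<longlonglongrightarrow> ennreal (l k * pmf (binomial_pmf k \<alpha>) j)"
      proof (rule AE_I2)
        fix k
        have "(\<lambda>n. pmf (binomial_pmf k (\<gamma> (r n))) j) \<longlonglongrightarrow> pmf (binomial_pmf k \<alpha>) j"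
          using g01 a01 by (auto intro!: tendsto_intros gr)
        then show "(\<lambda>n. u n k) \<longlonglongrightarrow> ennreal (l k * pmf (binomial_pmf k \<alpha>) j)"
          unfolding u_def by (intro tendsto_ennrealI tendsto_mult lim)
      qed
    qed
    moreover have "(\<integral>\<^sup>+ k. u n k \<partial>count_space UNIV) = ennreal (pmf q j)" for n
      unfolding u_def using pmf_thinning[OF g01, of "r n" "z (r n)" j] z[of "r n"] by simp
    ultimately show ?thesis
      by (simp add: LIMSEQ_const_iff)
  qed
  \<comment> \<open>Pointwise limits of probability mass functions may lose mass. Here they do not: each binomial law
    has mass 1, so by Tonelli \<open>l\<close> has the same total mass as \<open>q\<close>.\<close>
  have "(\<integral>\<^sup>+ k. ennreal (l k) \<partial>count_space UNIV)
        = (\<integral>\<^sup>+ k. (\<integral>\<^sup>+ j. ennreal (l k * pmf (binomial_pmf k \<alpha>) j) \<partial>count_space UNIV)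
              \<partial>count_space UNIV)"
    using l0 by (simp add: ennreal_mult nn_integral_cmult nn_integral_pmf_eq_1)
  also have "\<dots> = (\<integral>\<^sup>+ j. (\<integral>\<^sup>+ k. ennreal (l k * pmf (binomial_pmf k \<alpha>) j) \<partial>count_space UNIV)
              \<partial>count_space UNIV)"
    using nn_integral_fst_count_space
        [of "\<lambda>(k, j). ennreal (l k * pmf (binomial_pmf k \<alpha>) j)"]
      nn_integral_snd_count_space
        [of "\<lambda>(k, j). ennreal (l k * pmf (binomial_pmf k \<alpha>) j)"]
    by (simp del: pmf_binomial)
  also have "\<dots> = 1"
    by (simp add: q_eq nn_integral_pmf_eq_1)
  finally have mass: "(\<integral>\<^sup>+ k. ennreal (l k) \<partial>count_space UNIV) = 1" .
  have "pmf (thinning \<alpha> (embed_pmf l)) j = pmf q j" for j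
  proof -
    have "ennreal (pmf (thinning \<alpha> (embed_pmf l)) j) = ennreal (pmf q j)"
      unfolding pmf_thinning[OF a01] pmf_embed_pmf[OF l0 mass] by (rule q_eq)
    then show ?thesis by simp
  qed
  then have "q = thinning \<alpha> (embed_pmf l)"
    by (intro pmf_eqI) simp
  then show ?thesis
    by (auto simp: thinned_def)
qed

lemma thinned_subset_thinned_plus:
  assumes "0 \<le> \<alpha>"
  shows "thinned \<alpha> \<subseteq> thinned_plus \<alpha>"
  unfolding thinned_plus_def by (intro INT_greatest thinned_mono assms) auto

lemma thinned_plus_eq_thinned:
  assumes "0 < \<alpha>" "\<alpha> < 1"
  shows "thinned_plus \<alpha> = thinned \<alpha>"
proof
  show "thinned_plus \<alpha> \<subseteq> thinned \<alpha>"
  proof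
    fix q assume q: "q \<in> thinned_plus \<alpha>"
    define \<gamma> where "\<gamma> n = \<alpha> + (1 - \<alpha>) * inverse (real (Suc n))" for n
    have g: "\<alpha> < \<gamma> n" "\<gamma> n \<le> 1" for n
    proof -
      show "\<alpha> < \<gamma> n"
        using assms by (simp add: \<gamma>_def)
      have "(1 - \<alpha>) * inverse (real (Suc n)) \<le> (1 - \<alpha>) * 1"
        using assms by (intro mult_left_mono) (auto simp: inverse_le_1_iff)
      then show "\<gamma> n \<le> 1"
        by (simp add: \<gamma>_def)
    qed
    have "\<gamma> \<longlonglongrightarrow> \<alpha> + (1 - \<alpha>) * 0"
      unfolding \<gamma>_def by (intro tendsto_intros LIMSEQ_inverse_real_of_nat)
    then have "\<gamma> \<longlonglongrightarrow> \<alpha>"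
      by simp
    then show "q \<in> thinned \<alpha>"
    proof (rule thinned_closed_from_above[rotated 3])
      show "q \<in> thinned (\<gamma> n)" for n
        using q g[of n] by (auto simp: thinned_plus_def)
    qed (use assms g in \<open>auto intro: less_imp_le\<close>)
  qed
  show "thinned \<alpha> \<subseteq> thinned_plus \<alpha>"
    using assms by (intro thinned_subset_thinned_plus) auto
qed

section \<open>The chain of inclusions\<close>

theorem theorem4:
  shows "(\<forall>\<alpha>::real. 0 < \<alpha> \<and> \<alpha> < 1 \<longrightarrow> thinned_plus \<alpha> = thinned \<alpha>)
       \<and> thinned_plus 0 \<noteq> thinned 0
       \<and> (\<forall>\<alpha> \<beta>::real. 0 < \<alpha> \<and> \<alpha> < \<beta> \<and> \<beta> \<le> 1 \<longrightarrow>
            thinned 0 \<subset> thinned_plus 0 \<and> thinned_plus 0 \<subset> thinned \<alpha> \<and> thinned \<alpha> \<subset> thinned \<beta>)"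
proof -
  have "poisson_pmf 1 \<noteq> return_pmf 0"
  proof
    assume "poisson_pmf 1 = return_pmf 0"
    then have "set_pmf (poisson_pmf 1) = {0}"
      by simp
    then show False
      by (metis UNIV_I set_pmf_poisson singletonD zero_less_one zero_neq_one)
  qed
  then have ne: "thinned_plus 0 \<noteq> thinned 0"
    using poisson_in_thinned_plus_0[of 1] by (auto simp: thinned_0)
  then have zero: "thinned 0 \<subset> thinned_plus 0"
    using thinned_subset_thinned_plus[of 0] by auto
  have "thinned_plus 0 \<subset> thinned \<alpha>" if "0 < \<alpha>" "\<alpha> \<le> 1" for \<alpha>
  proof -
    \<comment> \<open>Any parameter strictly between 0 and \<open>\<alpha>\<close> separates the two families.\<close>
    have "thinned_plus 0 \<subseteq> thinned (\<alpha> / 2)"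
      using that by (auto simp: thinned_plus_def)
    also have "\<dots> \<subset> thinned \<alpha>"
      using that by (intro thinned_strict_mono) auto
    finally show ?thesis .
  qed
  then show ?thesis
    using ne zero by (simp add: thinned_plus_eq_thinned thinned_strict_mono)
qed

end
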